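(* Let $n\ge 1$ be an integer and let $s\le 2$ be a real number. Then $M(\mathbb{S}^{n-1},r_s,n+1)$ consists of regular simplices; that is, a configuration $X$ of $n+1$ points of the unit sphere $\mathbb{S}^{n-1}\subset\mathbb{R}^n$ belongs to $M(\mathbb{S}^{n-1},r_s,n+1)$ if and only if $X$ is the set of vertices of a regular $n$-simplex inscribed in $\mathbb{S}^{n-1}$.
   Context: Let $r(x,y)=\|x-y\|$ be the Euclidean distance. For $s\in\mathbb{R}$ define $r_s(x,y)=r(x,y)^s$ if $s>0$, $r_0(x,y)=\log r(x,y)$, and $r_s(x,y)=-r(x,y)^s$ if $s<0$. For $s\le 0$, where $r_s(x,x)$ is not a real number, only configurations of pairwise distinct points are considered. For a finite real sequence $A=(a_1,\dots,a_N)$ let $a_{(1)}\le\dots\le a_{(N)}$ be its elements in non-decreasing order. For real sequences $A,B$ of the same length $N$, write $A\vartriangleright B$ if $a_{(1)}+\dots+a_{(k)}\ge b_{(1)}+\dots+b_{(k)}$ for all $k=1,\dots,N$. $A$ and $B$ are incomparable if neither $A\vartriangleright B$ nor $B\vartriangleright A$. For a set $S$, a symmetric function $\rho$ on $S\times S$ and $X=(x_1,\dots,x_m)\in S^m$, let $R_\rho(X)$ be the sequence of the $m(m-1)/2$ numbers $\rho(x_i,x_j)$, $1\le i<j\le m$ (with repetition). $X\in S^m$ is an $M$-set in $S$ with respect to $\rho$ if for every $Y\in S^m$ either $R_\rho(X)\vartriangleright R_\rho(Y)$, or $R_\rho(X)$ and $R_\rho(Y)$ are incomparable (for $\rho=r_s$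 with $s\le 0$, both $X$ and $Y$ range over $m$-tuples of pairwise distinct points). $M(S,\rho,m)$ denotes the set of all $M$-sets $X\in S^m$; the order of the points is irrelevant. *)

theory Defs
  imports "HOL-Analysis.Analysis"
begin

definition dist_kernel :: "real \<Rightarrow> 'a::metric_space \<Rightarrow> 'a \<Rightarrow> real" where
  "dist_kernel s x y =
     (if s > 0 then dist x y powr s
      else if s = 0 then ln (dist x y)
      else - (dist x y powr s))"

definition dominates :: "real list \<Rightarrow> real list \<Rightarrow> bool" (infix "\<rhd>" 50) where
  "A \<rhd> B \<longleftrightarrow> length A = length B \<and>
     (\<forall>k\<in>{1..length A}. sum_list (take k (sort A)) \<ge> sum_list (take k (sort B)))"

definition incomparable :: "real list \<Rightarrow> real list \<Rightarrow> bool" where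
  "incomparable A B \<longleftrightarrow> \<not> A \<rhd> B \<and> \<not> B \<rhd> A"

definition pair_values :: "('a \<Rightarrow> 'a \<Rightarrow> real) \<Rightarrow> 'a list \<Rightarrow> real list" where
  "pair_values \<rho> X = [\<rho> (X ! i) (X ! j). i \<leftarrow> [0..<length X], j \<leftarrow> [Suc i..<length X]]"

text \<open>An \<open>m\<close>-tuple of points of \<open>S\<close> is a list of length \<open>m\<close> with entries in \<open>S\<close>. For
  \<open>s \<le> 0\<close> the kernel is not real-valued on the diagonal (in HOL it takes a default value
  there), so only tuples of pairwise distinct points are admitted; for \<open>s > 0\<close> repeated
  points are allowed.\<close>

definition configurations :: "'a set \<Rightarrow> real \<Rightarrow> nat \<Rightarrow> 'a list set" where
  "configurations S s m =
     {X. length X = m \<and> set X \<subseteq> S \<and> (s \<le> 0 \<longrightarrow> distinct X)}"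

text \<open>The set of M-sets among the tuples in \<open>C\<close>, the collection over which both the
  candidate and its competitors range.\<close>

definition M_sets_among :: "'a list set \<Rightarrow> ('a \<Rightarrow> 'a \<Rightarrow> real) \<Rightarrow> 'a list set" where
  "M_sets_among C \<rho> =
     {X \<in> C. \<forall>Y\<in>C. pair_values \<rho> X \<rhd> pair_values \<rho> Y \<or>
                    incomparable (pair_values \<rho> X) (pair_values \<rho> Y)}"

definition M_sets :: "'a::metric_space set \<Rightarrow> real \<Rightarrow> nat \<Rightarrow> 'a list set" where
  "M_sets S s m = M_sets_among (configurations S s m) (dist_kernel s)"

definition vertices :: "'a::real_vector set \<Rightarrow> 'a set" where
  "vertices T = {v. v extreme_point_of T}"

definition regular_simplex :: "nat \<Rightarrow> 'a::euclidean_space set \<Rightarrow> bool" where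
  "regular_simplex n T \<longleftrightarrow> int n simplex T \<and>
     (\<exists>l. \<forall>v\<in>vertices T. \<forall>w\<in>vertices T. v \<noteq> w \<longrightarrow> dist v w = l)"

end

theory Submission
  imports Defs
begin

text \<open>Write \<open>m = n + 1\<close>. By Lagrange's identity the squared distances between \<open>m\<close> points of the
  unit sphere have sum at most \<open>m\<^sup>2\<close>, with equality exactly when the points have sum 0. For
  \<open>s \<le> 2\<close> the kernel is an increasing concave function of the squared distance. Hence, by
  the tangent inequality, the total of the pair values of any configuration is at most the
  total for an equidistant configuration whose squared distances have sum \<open>m\<^sup>2\<close>. The pair values of
  the latter are all equal, and an average of the smallest terms of a sequence never exceeds the
  average of all of them, so the equidistant configuration dominates every other one
  (\<open>equidistant_dominates\<close>); in particular it is an M-set.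

  Conversely, an M-set is comparable with the equidistant configuration and therefore dominates
  it. Already the smallest pair values then show that no distance is below the common one, and
  the bound \<open>m\<^sup>2\<close> forces all distances to equal it (\<open>dominates_equidistant\<close>). This argument
  needs one equidistant configuration to compare with, which \<open>ex_equidistant_sphere\<close> writes
  down in coordinates.

  Finally, equidistance with this particular distance is the same as being the vertex set of a
  regular simplex (\<open>equidistant_iff_regular_simplex\<close>): the Gram matrix gives affine
  independence, and the edge length of an inscribed regular simplex is determined because its
  vertices have sum 0.\<close>

section \<open>Sequences of pair values\<close>

lemma pair_values_Nil [simp]: "pair_values \<rho> [] = []"
  by (simp add: pair_values_def)

lemma pair_values_Cons [simp]:
  "pair_values \<rho> (x # xs) = map (\<rho> x) xs @ pair_values \<rho> xs"
proof -
  have row: "map (\<lambda>j. \<rho> ((x # xs) ! i) ((x # xs) ! j)) [Suc i..<Suc (length xs)] =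
      map (\<lambda>j. \<rho> ((x # xs) ! i) (xs ! j)) [i..<length xs]" for i
    by (simp add: map_Suc_upt[symmetric] del: upt_Suc)
  have "map (\<lambda>j. \<rho> x (xs ! j)) [0..<length xs] = map (\<rho> x) xs"
    by (rule nth_equalityI) auto
  moreover have "[0..<Suc (length xs)] = 0 # map Suc [0..<length xs]"
    by (simp add: upt_conv_Cons map_Suc_upt del: upt_Suc)
  ultimately show ?thesis
    by (simp add: pair_values_def row o_def del: upt_Suc)
qed

lemma length_pair_values: "2 * length (pair_values \<rho> X) = length X * (length X - 1)"
proof (induction X)
  case (Cons x X)
  then show ?case by (cases "length X") (auto simp: algebra_simps)
qed simp

lemma pair_values_ball_iff:
  "(\<forall>v\<in>set (pair_values \<rho> X). P v) \<longleftrightarrow> sorted_wrt (\<lambda>x y. P (\<rho> x y)) X"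
  by (induction X) auto

lemma sum_list_pair_values_mono:
  assumes "sorted_wrt (\<lambda>x y. \<rho> x y \<le> \<sigma> x y) X"
  shows "sum_list (pair_values \<rho> X) \<le> sum_list (pair_values \<sigma> X)"
  using assms by (induction X) (auto intro!: add_mono sum_list_mono)

lemma sum_list_pair_values_affine:
  "sum_list (pair_values (\<lambda>x y. a + b * \<rho> x y) X) =
     a * real (length (pair_values \<rho> X)) + b * sum_list (pair_values \<rho> X)"
  by (induction X) (auto simp: sum_list_addf sum_list_const_mult sum_list_triv algebra_simps)

text \<open>Lagrange's identity: the squared distances of all pairs measure the squared distances
  to the origin, up to the displacement of the centroid.\<close>

lemma sum_list_pair_values_dist_sq:
  fixes X :: "'a::real_inner list"
  shows "sum_list (pair_values (\<lambda>x y. (dist x y)\<^sup>2) X) =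
    length X * (\<Sum>x\<leftarrow>X. (norm x)\<^sup>2) - (norm (sum_list X))\<^sup>2"
proof (induction X)
  case (Cons a X)
  have "(\<Sum>y\<leftarrow>X. (dist a y)\<^sup>2) =
      length X * (norm a)\<^sup>2 - 2 * (a \<bullet> sum_list X) + (\<Sum>y\<leftarrow>X. (norm y)\<^sup>2)"
    by (induction X)
      (auto simp: dist_norm power2_norm_eq_inner inner_commute algebra_simps)
  with Cons show ?case
    by (simp add: power2_norm_eq_inner inner_commute algebra_simps)
qed simp

section \<open>Domination by constant sequences\<close>

text \<open>An initial segment of a sorted sequence has at most the average of the whole sequence,
  because the terms that follow it are no smaller.\<close>

lemma sum_list_take_sort_le:
  fixes A :: "real list" and c :: real
  assumes sum: "sum_list A \<le> length A * c" and k: "k \<le> length A"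
  shows "sum_list (take k (sort A)) \<le> k * c"
proof (cases "\<forall>a\<in>set (take k (sort A)). a \<le> c")
  case True
  have "sum_list (take k (sort A)) \<le> (\<Sum>a\<leftarrow>take k (sort A). c)"
    using sum_list_mono[of "take k (sort A)" "\<lambda>a. a" "\<lambda>a. c"] True by simp
  then show ?thesis
    using k by (simp add: sum_list_triv)
next
  case False
  then obtain a where a: "a \<in> set (take k (sort A))" "c < a"
    by auto
  have "sorted (take k (sort A) @ drop k (sort A))"
    by simp
  with a have "\<forall>b\<in>set (drop k (sort A)). c \<le> b"
    unfolding sorted_append by fastforce
  then have "(\<Sum>b\<leftarrow>drop k (sort A). c) \<le> sum_list (drop k (sort A))"
    using sum_list_mono[of "drop k (sort A)" "\<lambda>b. c" "\<lambda>b. b"] by simp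
  then have "real (length A - k) * c \<le> sum_list (drop k (sort A))"
    by (simp add: sum_list_triv)
  moreover have "sum_list (take k (sort A)) + sum_list (drop k (sort A)) = sum_list A"
    by (metis append_take_drop_id mset_sort sum_list_append sum_mset_sum_list)
  ultimately show ?thesis
    using sum k by (simp add: of_nat_diff algebra_simps)
qed

lemma sort_replicate [simp]: "sort (replicate n c) = replicate n c"
  by (simp add: sort_key_id_if_sorted)

lemma replicate_dominates:
  fixes A :: "real list" and c :: real
  assumes "sum_list A \<le> length A * c" "length A = n"
  shows "replicate n c \<rhd> A"
  using assms sum_list_take_sort_le[of A c]
  by (auto simp: dominates_def sum_list_replicate)

lemma dominates_replicateD:
  assumes "A \<rhd> replicate n c" "a \<in> set A"
  shows "c \<le> a"
proof -
  have len: "length A = n" and n: "1 \<le> n"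
    using assms by (auto simp: dominates_def Suc_le_eq)
  obtain b B where B: "sort A = b # B"
    using assms(2) by (cases "sort A") (auto dest: arg_cong[of _ _ set])
  have "\<forall>k\<in>{1..length A}. sum_list (take k (sort (replicate n c))) \<le> sum_list (take k (sort A))"
    using assms(1) unfolding dominates_def by blast
  moreover have "(1::nat) \<in> {1..length A}"
    using len n by simp
  ultimately have "sum_list (take 1 (sort (replicate n c))) \<le> sum_list (take 1 (sort A))"
    by blast
  then have "c \<le> b"
    using n unfolding sort_replicate B by (cases n) auto
  moreover have "b \<le> a"
  proof -
    have "sorted (b # B)" "set (b # B) = set A"
      by (simp_all flip: B)
    with assms(2) show ?thesis by auto
  qed
  ultimately show ?thesis by simp
qed

section \<open>The kernels as functions of the squared distance\<close>

definition radial :: "real \<Rightarrow> real \<Rightarrow> real" where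
  "radial s d = (if s > 0 then d powr s else if s = 0 then ln d else - (d powr s))"

lemma dist_kernel_radial: "dist_kernel s x y = radial s (dist x y)"
  by (simp add: dist_kernel_def radial_def)

lemma radial_le_imp_le:
  assumes "radial s c \<le> radial s d" "0 < c" "0 \<le> d" "s \<le> 0 \<Longrightarrow> 0 < d"
  shows "c \<le> d"
proof (rule ccontr)
  assume "\<not> c \<le> d"
  then have "d < c" by simp
  consider "s > 0" | "s = 0" | "s < 0" by linarith
  then have "radial s d < radial s c"
  proof cases
    case 1
    with \<open>d < c\<close> assms(3) show ?thesis
      by (simp add: radial_def powr_less_mono2)
  next
    case 2
    with \<open>d < c\<close> assms(4) show ?thesis
      by (simp add: radial_def)
  next
    case 3
    with \<open>d < c\<close> assms(4) show ?thesis
      by (simp add: radial_def powr_less_mono2_neg)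
  qed
  with assms(1) show False by simp
qed

lemma powr_le_tangent_at_1:
  fixes p u :: real
  assumes "0 \<le> u" "0 < p" "p \<le> 1"
  shows "u powr p \<le> 1 + p * (u - 1)"
proof (cases "u = 0")
  case False
  with assms show ?thesis
    using Youngs_inequality_0[of p "1 - p" u 1] by (simp add: algebra_simps)
qed (use assms in simp)

lemma powr_ge_tangent_at_1:
  fixes p u :: real
  assumes "0 < u" "p < 0"
  shows "1 + p * (u - 1) \<le> u powr p"
proof -
  have "1 + p * (u - 1) \<le> 1 + p * ln u"
    using assms ln_le_minus_one[of u] by (simp add: mult_le_cancel_left)
  also have "\<dots> \<le> exp (p * ln u)"
    by (rule exp_ge_add_one_self)
  finally show ?thesis
    using assms by (simp add: powr_def)
qed

text \<open>This is where the bound on the exponent enters: as a function of the squared distance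
  \<open>t\<close> the kernel is \<open>t powr (s/2)\<close> with \<open>0 < s/2 \<le> 1\<close>, or \<open>ln t / 2\<close>, or
  \<open>- (t powr (s/2))\<close> with \<open>s/2 < 0\<close>. Each of these is concave and increasing, so it lies below its
  tangent at \<open>c\<^sup>2\<close>. The slope \<open>K\<close> does not depend on \<open>d\<close>, so that the inequality can be summed
  over all pairs of points.\<close>

lemma radial_le_tangent:
  assumes s: "s \<le> 2" and c: "0 < c"
  obtains K where "0 \<le> K"
    "\<And>d. 0 \<le> d \<Longrightarrow> (s \<le> 0 \<Longrightarrow> 0 < d) \<Longrightarrow> radial s d \<le> radial s c + K * (d\<^sup>2 - c\<^sup>2)"
proof -
  \<comment> \<open>Scaling by \<open>c\<close> moves the point of tangency to 1.\<close>
  have scale: "d powr s = c powr s * ((d / c)\<^sup>2) powr (s / 2)" if "0 \<le> d" for d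
  proof -
    have "((d / c)\<^sup>2) powr (s / 2) = (d / c) powr s"
    proof (cases "d = 0")
      case False
      with that c have "((d / c)\<^sup>2) = (d / c) powr 2"
        by simp
      then show ?thesis by (simp only: powr_powr) simp
    qed simp
    then show ?thesis
      using that c by (simp add: powr_divide)
  qed
  consider "s > 0" | "s = 0" | "s < 0" by linarith
  then show thesis
  proof cases
    case 1
    show thesis
    proof (rule that)
      show "0 \<le> c powr s * (s / 2) / c\<^sup>2"
        using 1 by simp
      fix d :: real
      assume d: "0 \<le> d"
      have "c powr s * ((d / c)\<^sup>2) powr (s / 2) \<le> c powr s * (1 + s / 2 * ((d / c)\<^sup>2 - 1))"
        using 1 s by (intro mult_left_mono powr_le_tangent_at_1) auto
      also have "\<dots> = c powr s + c powr s * (s / 2) / c\<^sup>2 * (d\<^sup>2 - c\<^sup>2)"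
        using c by (simp add: field_simps)
      finally show "radial s d \<le> radial s c + c powr s * (s / 2) / c\<^sup>2 * (d\<^sup>2 - c\<^sup>2)"
        using 1 scale[OF d] by (simp add: radial_def)
    qed
  next
    case 2
    show thesis
    proof (rule that)
      show "0 \<le> 1 / (2 * c\<^sup>2)"
        by simp
      fix d :: real
      assume "s \<le> 0 \<Longrightarrow> 0 < d"
      with 2 have d: "0 < d" by simp
      have "2 * (ln d - ln c) = ln ((d / c)\<^sup>2)"
        using d c by (simp add: ln_realpow ln_div)
      also have "\<dots> \<le> (d / c)\<^sup>2 - 1"
        using d c by (intro ln_le_minus_one) simp
      finally show "radial s d \<le> radial s c + 1 / (2 * c\<^sup>2) * (d\<^sup>2 - c\<^sup>2)"
        using 2 c by (simp add: radial_def field_simps)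
    qed
  next
    case 3
    show thesis
    proof (rule that)
      show "0 \<le> c powr s * (- s / 2) / c\<^sup>2"
        using 3 by (intro divide_nonneg_nonneg mult_nonneg_nonneg) auto
      fix d :: real
      assume "s \<le> 0 \<Longrightarrow> 0 < d"
      with 3 have d: "0 < d" by simp
      have "c powr s * (1 + s / 2 * ((d / c)\<^sup>2 - 1)) \<le> c powr s * ((d / c)\<^sup>2) powr (s / 2)"
        using 3 d c by (intro mult_left_mono powr_ge_tangent_at_1) auto
      moreover have "c powr s * (1 + s / 2 * ((d / c)\<^sup>2 - 1)) =
          c powr s - c powr s * (- s / 2) / c\<^sup>2 * (d\<^sup>2 - c\<^sup>2)"
        using c by (simp add: field_simps)
      ultimately show "radial s d \<le> radial s c + c powr s * (- s / 2) / c\<^sup>2 * (d\<^sup>2 - c\<^sup>2)"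
        using 3 scale[of d] d by (simp add: radial_def)
    qed
  qed
qed

section \<open>Equidistant configurations are the M-sets\<close>

definition equidistant :: "real \<Rightarrow> 'a::metric_space list \<Rightarrow> bool" where
  "equidistant d X \<longleftrightarrow> sorted_wrt (\<lambda>x y. dist x y = d) X"

lemma equidistant_distinct:
  assumes "equidistant d X" "d \<noteq> 0"
  shows "distinct X"
  using assms unfolding equidistant_def by (induction X) auto

lemma equidistantD:
  assumes "equidistant d X" "x \<in> set X" "y \<in> set X" "x \<noteq> y"
  shows "dist x y = d"
  using assms unfolding equidistant_def by (induction X) (auto simp: dist_commute)

lemma equidistantI:
  assumes "distinct X" "\<And>x y. x \<in> set X \<Longrightarrow> y \<in> set X \<Longrightarrow> x \<noteq> y \<Longrightarrow> dist x y = d"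
  shows "equidistant d X"
  using assms unfolding equidistant_def by (induction X) auto

lemma equidistant_pair_values:
  assumes "equidistant d X"
  shows "pair_values (\<lambda>x y. f (dist x y)) X =
    replicate (length (pair_values (\<lambda>x y. f (dist x y)) X)) (f d)"
proof -
  have "\<forall>v\<in>set (pair_values (\<lambda>x y. f (dist x y)) X). v = f d"
    unfolding pair_values_ball_iff
    using assms unfolding equidistant_def by (auto elim: sorted_wrt_mono_rel[rotated])
  then show ?thesis
    by (metis replicate_length_same)
qed

text \<open>The root mean square distance of \<open>m\<close> points of a unit sphere that are balanced about
  its centre; also the edge length of the regular simplex with \<open>m\<close> vertices and
  circumradius 1.\<close>

definition simplex_edge :: "nat \<Rightarrow> real" where
  "simplex_edge m = sqrt (2 * m / (m - 1))"

lemma simplex_edge_pos: "2 \<le> m \<Longrightarrow> 0 < simplex_edge m"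
  by (simp add: simplex_edge_def)

lemma length_pair_values_mult_simplex_edge:
  assumes "2 \<le> length X"
  shows "real (length (pair_values \<rho> X)) * (simplex_edge (length X))\<^sup>2 = (real (length X))\<^sup>2"
proof -
  have "2 * real (length (pair_values \<rho> X)) = real (length X * (length X - 1))"
    using length_pair_values[of \<rho> X] by (metis of_nat_mult of_nat_numeral)
  then have "real (length (pair_values \<rho> X)) = length X * (real (length X) - 1) / 2"
    using assms by (simp add: of_nat_diff)
  moreover have "(simplex_edge (length X))\<^sup>2 = 2 * length X / (real (length X) - 1)"
    using assms by (simp add: simplex_edge_def of_nat_diff)
  moreover have "real (length X) - 1 \<noteq> 0"
    using assms by auto
  ultimately show ?thesis
    by (simp only:) (simp add: field_simps power2_eq_square)
qed

lemma sphere_sum_dist_sq: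
  fixes X :: "'a::real_inner list"
  assumes "set X \<subseteq> sphere 0 1"
  shows "sum_list (pair_values (\<lambda>x y. (dist x y)\<^sup>2) X) =
    (real (length X))\<^sup>2 - (norm (sum_list X))\<^sup>2"
proof -
  have "(\<Sum>x\<leftarrow>X. (norm x)\<^sup>2) = length X"
    using assms by (induction X) auto
  then show ?thesis
    by (simp only: sum_list_pair_values_dist_sq) (simp add: power2_eq_square)
qed

text \<open>The tangent inequality at the root mean square distance, summed over all pairs, bounds
  the total by its value at equal distances. The total bounds all partial sums.\<close>

lemma equidistant_dominates:
  fixes X Y :: "'a::real_inner list"
  assumes s: "s \<le> 2" and m: "2 \<le> m"
    and X: "length X = m" "equidistant (simplex_edge m) X"
    and Y: "Y \<in> configurations (sphere 0 1) s m"
  shows "pair_values (dist_kernel s) X \<rhd> pair_values (dist_kernel s) Y"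
proof -
  let ?d = "simplex_edge m" and ?N = "length (pair_values (dist_kernel s) Y)"
  have Y': "length Y = m" "set Y \<subseteq> sphere 0 1" "s \<le> 0 \<Longrightarrow> distinct Y"
    using Y by (auto simp: configurations_def)
  have lens: "length (pair_values \<rho> Z) = ?N" if "length Z = m" for \<rho> and Z :: "'a list"
    using length_pair_values[of \<rho> Z] length_pair_values[of "dist_kernel s" Y] that Y' by simp
  obtain K where K: "0 \<le> K"
    "\<And>d. 0 \<le> d \<Longrightarrow> (s \<le> 0 \<Longrightarrow> 0 < d) \<Longrightarrow> radial s d \<le> radial s ?d + K * (d\<^sup>2 - ?d\<^sup>2)"
    using radial_le_tangent[OF s simplex_edge_pos[OF m]] by metis
  have pairs: "sorted_wrt (\<lambda>x y. s \<le> 0 \<longrightarrow> x \<noteq> y) Y"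
    using Y'(3) by (induction Y) auto
  have "sorted_wrt (\<lambda>x y. dist_kernel s x y \<le>
      (radial s ?d - K * ?d\<^sup>2) + K * (dist x y)\<^sup>2) Y"
    by (rule sorted_wrt_mono_rel[OF _ pairs])
      (use K(2) in \<open>force simp: dist_kernel_radial algebra_simps\<close>)
  then have "sum_list (pair_values (dist_kernel s) Y) \<le>
      sum_list (pair_values (\<lambda>x y. (radial s ?d - K * ?d\<^sup>2) + K * (dist x y)\<^sup>2) Y)"
    by (rule sum_list_pair_values_mono)
  also have "\<dots> = (radial s ?d - K * ?d\<^sup>2) * ?N +
      K * sum_list (pair_values (\<lambda>x y. (dist x y)\<^sup>2) Y)"
    by (simp only: sum_list_pair_values_affine lens[OF Y'(1), of "\<lambda>x y. (dist x y)\<^sup>2"])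
  also have "\<dots> \<le> (radial s ?d - K * ?d\<^sup>2) * ?N + K * (?N * ?d\<^sup>2)"
  proof -
    have "sum_list (pair_values (\<lambda>x y. (dist x y)\<^sup>2) Y) \<le> ?N * ?d\<^sup>2"
      using sphere_sum_dist_sq[OF Y'(2)] m Y'(1)
        length_pair_values_mult_simplex_edge[of Y "dist_kernel s"]
      by simp
    then show ?thesis
      using K(1) by (intro add_left_mono mult_left_mono)
  qed
  also have "\<dots> = ?N * radial s ?d"
    by (simp add: algebra_simps)
  finally have "replicate ?N (radial s ?d) \<rhd> pair_values (dist_kernel s) Y"
    by (rule replicate_dominates) simp
  moreover have "pair_values (dist_kernel s) X = replicate ?N (radial s ?d)"
    using equidistant_pair_values[OF X(2), of "radial s"] lens[OF X(1), of "dist_kernel s"]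
    by (simp flip: dist_kernel_radial)
  ultimately show ?thesis by simp
qed

text \<open>The converse compares smallest terms only: a configuration that dominates the
  equidistant one has no distance below the edge length, while the sum of its squared
  distances leaves no room for a larger one.\<close>

lemma dominates_equidistant:
  fixes X Y :: "'a::real_inner list"
  assumes m: "2 \<le> m"
    and X: "length X = m" "equidistant (simplex_edge m) X"
    and Y: "Y \<in> configurations (sphere 0 1) s m"
    and dom: "pair_values (dist_kernel s) Y \<rhd> pair_values (dist_kernel s) X"
  shows "equidistant (simplex_edge m) Y"
proof -
  let ?d = "simplex_edge m"
  let ?Q = "pair_values (\<lambda>x y. (dist x y)\<^sup>2) Y"
  have Y': "length Y = m" "set Y \<subseteq> sphere 0 1" "s \<le> 0 \<Longrightarrow> distinct Y"
    using Y by (auto simp: configurations_def)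
  define N where "N = length (pair_values (dist_kernel s) X)"
  have "pair_values (dist_kernel s) X = replicate N (radial s ?d)"
    unfolding N_def using equidistant_pair_values[OF X(2), of "radial s"]
    by (simp flip: dist_kernel_radial)
  then have "\<forall>v\<in>set (pair_values (dist_kernel s) Y). radial s ?d \<le> v"
    using dom dominates_replicateD by metis
  then have "sorted_wrt (\<lambda>x y. radial s ?d \<le> radial s (dist x y)) Y"
    by (simp add: pair_values_ball_iff dist_kernel_radial)
  moreover have "sorted_wrt (\<lambda>x y. s \<le> 0 \<longrightarrow> x \<noteq> y) Y"
    using Y'(3) by (induction Y) auto
  ultimately have "sorted_wrt (\<lambda>x y. radial s ?d \<le> radial s (dist x y) \<and> (s \<le> 0 \<longrightarrow> x \<noteq> y)) Y"
    by (induction Y) auto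
  then have "sorted_wrt (\<lambda>x y. ?d\<^sup>2 \<le> (dist x y)\<^sup>2) Y"
  proof (rule sorted_wrt_mono_rel[rotated])
    fix x y :: 'a
    assume "radial s ?d \<le> radial s (dist x y) \<and> (s \<le> 0 \<longrightarrow> x \<noteq> y)"
    then have "?d \<le> dist x y"
      using simplex_edge_pos[OF m] by (intro radial_le_imp_le[of s ?d]) auto
    then show "?d\<^sup>2 \<le> (dist x y)\<^sup>2"
      using simplex_edge_pos[OF m] by (intro power_mono) auto
  qed
  then have ge: "\<forall>v\<in>set ?Q. ?d\<^sup>2 \<le> v"
    by (simp add: pair_values_ball_iff)
  have "sum_list ?Q \<le> length ?Q * ?d\<^sup>2"
    using sphere_sum_dist_sq[OF Y'(2)] m Y'(1)
      length_pair_values_mult_simplex_edge[of Y "\<lambda>x y. (dist x y)\<^sup>2"] by simp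
  then have "(\<Sum>v\<leftarrow>?Q. v - ?d\<^sup>2) \<le> 0"
    by (simp add: sum_list_subtractf sum_list_triv)
  then have "(\<Sum>v\<leftarrow>?Q. v - ?d\<^sup>2) = 0"
    using ge by (intro antisym sum_list_nonneg) auto
  then have "\<forall>v\<in>set ?Q. v = ?d\<^sup>2"
    using ge by (subst (asm) sum_list_nonneg_eq_0_iff) auto
  then have "sorted_wrt (\<lambda>x y. (dist x y)\<^sup>2 = ?d\<^sup>2) Y"
    by (simp add: pair_values_ball_iff)
  then show ?thesis
    unfolding equidistant_def using simplex_edge_pos[OF m]
    by (elim sorted_wrt_mono_rel[rotated]) (simp add: power2_eq_iff_nonneg)
qed

lemma M_sets_sphere_equidistant:
  fixes E :: "'a::real_inner list"
  assumes s: "s \<le> 2" and m: "2 \<le> m"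
    and E: "length E = m" "set E \<subseteq> sphere 0 1" "equidistant (simplex_edge m) E"
  shows "M_sets (sphere (0::'a) 1) s m =
    {X. length X = m \<and> set X \<subseteq> sphere 0 1 \<and> equidistant (simplex_edge m) X}"
proof -
  have conf: "X \<in> configurations (sphere 0 1) s m"
    if "length X = m" "set X \<subseteq> sphere 0 1" "equidistant (simplex_edge m) X" for X :: "'a list"
    using that equidistant_distinct simplex_edge_pos[OF m] by (fastforce simp: configurations_def)
  show ?thesis
  proof (intro subset_antisym subsetI CollectI)
    fix X :: "'a list"
    assume "X \<in> M_sets (sphere 0 1) s m"
    then have X: "X \<in> configurations (sphere 0 1) s m"
      and "pair_values (dist_kernel s) X \<rhd> pair_values (dist_kernel s) E \<or>
        incomparable (pair_values (dist_kernel s) X) (pair_values (dist_kernel s) E)"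
      using conf[OF E] by (auto simp: M_sets_def M_sets_among_def)
    with equidistant_dominates[OF s m E(1,3) X]
    have "pair_values (dist_kernel s) X \<rhd> pair_values (dist_kernel s) E"
      by (auto simp: incomparable_def)
    then show "length X = m \<and> set X \<subseteq> sphere 0 1 \<and> equidistant (simplex_edge m) X"
      using dominates_equidistant[OF m E(1,3) X] X by (simp add: configurations_def)
  next
    fix X :: "'a list"
    assume "X \<in> {X. length X = m \<and> set X \<subseteq> sphere 0 1 \<and> equidistant (simplex_edge m) X}"
    then have "length X = m" "set X \<subseteq> sphere 0 1" "equidistant (simplex_edge m) X"
      by auto
    then show "X \<in> M_sets (sphere 0 1) s m"
      using conf equidistant_dominates[OF s m] unfolding M_sets_def M_sets_among_def by blast
  qed
qed

section \<open>Equidistant configurations are the regular simplices\<close>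

lemma inner_unit_equidistant:
  fixes x y :: "'a::real_inner"
  assumes "norm x = 1" "norm y = 1"
  shows "x \<bullet> y = 1 - (dist x y)\<^sup>2 / 2"
  using assms dot_norm_neg[of x y] by (simp add: dist_norm)

text \<open>The Gram matrix of \<open>V\<close> is \<open>d\<^sup>2/2\<close> times the identity plus a constant matrix; the
  constant part vanishes on coefficients with sum 0.\<close>

lemma equidistant_affine_independent:
  fixes V :: "'a::real_inner set"
  assumes fin: "finite V" and V: "V \<subseteq> sphere 0 1" and d: "d \<noteq> 0"
    and dist: "\<And>x y. x \<in> V \<Longrightarrow> y \<in> V \<Longrightarrow> x \<noteq> y \<Longrightarrow> dist x y = d"
  shows "\<not> affine_dependent V"
proof
  assume "affine_dependent V"
  then obtain u where u: "sum u V = 0" "\<exists>v\<in>V. u v \<noteq> 0" "(\<Sum>v\<in>V. u v *\<^sub>R v) = 0"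
    using affine_dependent_explicit_finite[OF fin] by auto
  have inner: "v \<bullet> w = (1 - d\<^sup>2 / 2) + (if v = w then d\<^sup>2 / 2 else 0)"
    if "v \<in> V" "w \<in> V" for v w
    using that V dist[OF that] inner_unit_equidistant[of v w]
    by (auto simp: subset_iff norm_eq_1)
  have row: "(\<Sum>w\<in>V. u w * (v \<bullet> w)) = u v * (d\<^sup>2 / 2)" if "v \<in> V" for v
  proof -
    have "(\<Sum>w\<in>V. u w * (v \<bullet> w)) =
        (\<Sum>w\<in>V. (1 - d\<^sup>2 / 2) * u w + (if v = w then u w * (d\<^sup>2 / 2) else 0))"
      using that by (intro sum.cong) (auto simp: inner algebra_simps)
    also have "\<dots> = (1 - d\<^sup>2 / 2) * sum u V + u v * (d\<^sup>2 / 2)"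
      using that fin by (simp only: sum.distrib sum_distrib_left sum.delta' if_True)
    finally show ?thesis using u(1) by simp
  qed
  have "u v = 0" if "v \<in> V" for v
  proof -
    have "0 = v \<bullet> (\<Sum>w\<in>V. u w *\<^sub>R w)"
      by (simp add: u(3))
    also have "\<dots> = u v * (d\<^sup>2 / 2)"
      using row[OF that] by (simp add: inner_sum_right)
    finally show ?thesis using d by simp
  qed
  with u(2) show False by blast
qed

text \<open>The edge length of an inscribed regular simplex is forced: the vertices have equal inner
  products with their sum, so they lie in a hyperplane unless that sum is 0, and then
  Lagrange's identity gives the sum of the squared distances.\<close>

lemma regular_simplex_edge:
  fixes X :: "'a::euclidean_space list"
  assumes len: "length X = DIM('a) + 1" and X: "set X \<subseteq> sphere 0 1"
    and indep: "\<not> affine_dependent (set X)" and dist: "equidistant l X" and dX: "distinct X"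
  shows "l = simplex_edge (length X)"
proof -
  let ?z = "\<Sum>(set X)"
  let ?c = "1 + DIM('a) * (1 - l\<^sup>2 / 2)"
  have card: "card (set X) = DIM('a) + 1"
    using len dX by (simp add: distinct_card)
  have inner_z: "?z \<bullet> v = ?c" if v: "v \<in> set X" for v
  proof -
    have "?z \<bullet> v = (\<Sum>w\<in>set X. w \<bullet> v)"
      by (simp add: inner_sum_left)
    also have "\<dots> = v \<bullet> v + (\<Sum>w\<in>set X - {v}. w \<bullet> v)"
      using v by (simp add: sum.remove)
    also have "(\<Sum>w\<in>set X - {v}. w \<bullet> v) = (\<Sum>w\<in>set X - {v}. 1 - l\<^sup>2 / 2)"
      using v X equidistantD[OF dist] inner_unit_equidistant[of _ v]
      by (intro sum.cong) (auto simp: subset_iff)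
    also have "v \<bullet> v = 1"
      using v X by (auto simp: subset_iff norm_eq_1)
    finally show ?thesis
      using v card by simp
  qed
  have "affine hull (set X) = UNIV"
    using affine_independent_span_eq[OF indep] card by simp
  moreover have "affine hull (set X) \<subseteq> {v. ?z \<bullet> v = ?c}"
    using inner_z by (intro hull_minimal affine_hyperplane) auto
  ultimately have all: "?z \<bullet> v = ?c" for v
    by auto
  from all[of 0] all[of ?z] have "?z = 0"
    by simp
  then have "sum_list X = 0"
    using dX by (simp add: sum_list_distinct_conv_sum_set[of X "\<lambda>x. x", simplified])
  then have total: "sum_list (pair_values (\<lambda>x y. (dist x y)\<^sup>2) X) = (real (length X))\<^sup>2"
    using sphere_sum_dist_sq[OF X] by simp
  define N where "N = length (pair_values (\<lambda>x y. (dist x y)\<^sup>2) X)"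
  have "pair_values (\<lambda>x y. (dist x y)\<^sup>2) X = replicate N (l\<^sup>2)"
    unfolding N_def by (rule equidistant_pair_values[OF dist])
  then have sum_l: "N * l\<^sup>2 = (real (length X))\<^sup>2"
    by (simp add: sum_list_replicate flip: total)
  also have "(real (length X))\<^sup>2 = N * (simplex_edge (length X))\<^sup>2"
    using length_pair_values_mult_simplex_edge[of X] len unfolding N_def
    by (simp add: Suc_le_eq)
  finally have "l\<^sup>2 = (simplex_edge (length X))\<^sup>2"
    using sum_l len by auto
  moreover have "0 \<le> l"
  proof -
    obtain x y Z where "X = x # y # Z"
      using len DIM_positive[where 'a='a] by (cases X; cases "tl X") auto
    with dist have "l = dist x y" by (simp add: equidistant_def)
    then show ?thesis by simp
  qed
  moreover have "0 < simplex_edge (length X)"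
    using len by (intro simplex_edge_pos) (simp add: Suc_le_eq)
  ultimately show ?thesis
    by (simp add: power2_eq_iff_nonneg)
qed

lemma vertices_convex_hull:
  fixes V :: "'a::euclidean_space set"
  shows "\<not> affine_dependent V \<Longrightarrow> vertices (convex hull V) = V"
  by (simp add: vertices_def extreme_point_of_convex_hull_affine_independent)

lemma equidistant_iff_regular_simplex:
  fixes X :: "'a::euclidean_space list"
  assumes len: "length X = DIM('a) + 1" and X: "set X \<subseteq> sphere 0 1"
  shows "equidistant (simplex_edge (length X)) X \<longleftrightarrow>
    (\<exists>T. regular_simplex DIM('a) T \<and> set X = vertices T)"
proof
  assume eq: "equidistant (simplex_edge (length X)) X"
  have pos: "simplex_edge (length X) \<noteq> 0"
    using len simplex_edge_pos[of "length X"] by (simp add: Suc_le_eq)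
  have indep: "\<not> affine_dependent (set X)"
    using X pos equidistantD[OF eq] by (intro equidistant_affine_independent) auto
  moreover have "card (set X) = DIM('a) + 1"
    using len equidistant_distinct[OF eq pos] by (simp add: distinct_card)
  ultimately have "int DIM('a) simplex (convex hull set X)"
    unfolding simplex_def by (intro exI[of _ "set X"]) auto
  then have "regular_simplex DIM('a) (convex hull set X)"
    unfolding regular_simplex_def vertices_convex_hull[OF indep]
    using equidistantD[OF eq] by blast
  then show "\<exists>T. regular_simplex DIM('a) T \<and> set X = vertices T"
    using vertices_convex_hull[OF indep] by blast
next
  assume "\<exists>T. regular_simplex DIM('a) T \<and> set X = vertices T"
  then obtain C l where C: "\<not> affine_dependent C" "int (card C) = int DIM('a) + 1"
    and XC: "set X = C" and l: "\<forall>v\<in>set X. \<forall>w\<in>set X. v \<noteq> w \<longrightarrow> dist v w = l"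
    unfolding regular_simplex_def simplex_def using vertices_convex_hull by metis
  have dX: "distinct X"
    using C(2) XC len by (intro card_distinct) simp
  then have "equidistant l X"
    using l by (intro equidistantI) auto
  moreover from this have "l = simplex_edge (length X)"
    using regular_simplex_edge[OF len X] C(1) XC dX by simp
  ultimately show "equidistant (simplex_edge (length X)) X" by simp
qed

section \<open>An inscribed regular simplex\<close>

text \<open>The vertices are \<open>-1/sqrt n\<close> times the all-ones vector \<open>e\<close> and the
  translates \<open>\<alpha> axis i + \<beta> e\<close> of multiples of the basis vectors. The value of \<open>\<alpha>\<close> is the
  one that makes the distance of two translates right; \<open>\<beta>\<close> then puts the centroid at 0.\<close>

lemma ex_equidistant_sphere:
  obtains E :: "(real ^ 'n) list" where "length E = CARD('n) + 1" "set E \<subseteq> sphere 0 1"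
    "equidistant (simplex_edge (CARD('n) + 1)) E"
proof -
  define n where "n = real CARD('n)"
  have n: "n > 0" unfolding n_def by simp
  define \<alpha> where "\<alpha> = sqrt ((n + 1) / n)"
  define \<beta> where "\<beta> = (1 / sqrt n - \<alpha>) / n"
  define e :: "real ^ 'n" where "e = (\<chi> i. 1)"
  define p :: "real ^ 'n" where "p = (- 1 / sqrt n) *\<^sub>R e"
  define q :: "'n \<Rightarrow> real ^ 'n" where "q i = \<alpha> *\<^sub>R axis i 1 + \<beta> *\<^sub>R e" for i
  have ee: "e \<bullet> e = n"
    by (simp add: e_def inner_vec_def n_def)
  have ae: "axis i 1 \<bullet> e = 1" "e \<bullet> axis i 1 = 1" for i
    by (simp_all add: e_def inner_axis inner_axis' inner_commute)
  have aa: "axis i 1 \<bullet> (axis j 1 :: real ^ 'n) = (if i = j then 1 else 0)" for i j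
    by (simp add: inner_axis_axis)
  have sq: "sqrt n * sqrt n = n"
    using n by simp
  have \<alpha>2: "\<alpha> * \<alpha> = 1 + 1 / n"
    using n by (simp add: \<alpha>_def field_simps)
  have \<alpha>\<beta>: "\<alpha> + n * \<beta> = 1 / sqrt n"
    using n by (simp add: \<beta>_def)
  have "2 * \<alpha> * \<beta> + n * \<beta> * \<beta> = ((\<alpha> + n * \<beta>) * (\<alpha> + n * \<beta>) - \<alpha> * \<alpha>) / n"
    using n by (simp add: field_simps)
  also have "\<dots> = - 1 / n"
    unfolding \<alpha>\<beta> \<alpha>2 using n sq by (simp add: field_simps)
  finally have \<beta>2: "2 * \<alpha> * \<beta> + n * \<beta> * \<beta> = - 1 / n" .
  have pp: "p \<bullet> p = 1"
    using n sq by (simp add: p_def ee field_simps)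
  have pq: "p \<bullet> q i = - 1 / n" for i
  proof -
    have "p \<bullet> q i = - 1 / sqrt n * (\<alpha> + n * \<beta>)"
      by (simp add: p_def q_def inner_add ee ae mult.commute add_divide_distrib)
    then show ?thesis
      unfolding \<alpha>\<beta> using sq by simp
  qed
  have qq: "q i \<bullet> q j = (if i = j then 1 else - 1 / n)" for i j
  proof -
    have "q i \<bullet> q j = \<alpha> * \<alpha> * (if i = j then 1 else 0) + (2 * \<alpha> * \<beta> + n * \<beta> * \<beta>)"
      by (simp add: q_def inner_add ee ae aa algebra_simps)
    then show ?thesis
      unfolding \<beta>2 \<alpha>2 by simp
  qed
  have edge: "dist x y = simplex_edge (CARD('n) + 1)"
    if "x \<bullet> x = 1" "y \<bullet> y = 1" "x \<bullet> y = - 1 / n" for x y :: "real ^ 'n"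
  proof -
    have "(dist x y)\<^sup>2 = 2 * (n + 1) / n"
      using that n inner_unit_equidistant[of x y] by (simp add: norm_eq_1 field_simps)
    then show ?thesis
      by (simp add: simplex_edge_def n_def real_sqrt_unique add.commute)
  qed
  have pq_edge: "dist p (q i) = simplex_edge (CARD('n) + 1)" for i
    by (rule edge) (simp_all only: pp pq qq simp_thms if_True)
  have qq_edge: "dist (q i) (q j) = simplex_edge (CARD('n) + 1)" if "i \<noteq> j" for i j
    by (rule edge) (simp_all only: qq that simp_thms if_True if_False)
  obtain I :: "'n list" where I: "set I = UNIV" "distinct I"
    using finite_distinct_list[of "UNIV :: 'n set"] by auto
  show thesis
  proof (rule that)
    show "length (p # map q I) = CARD('n) + 1"
      using distinct_card[OF I(2)] I(1) by simp
    show "set (p # map q I) \<subseteq> sphere 0 1"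
      using pp qq by (auto simp: norm_eq_1)
    have "sorted_wrt (\<noteq>) I"
      using I(2) by (induction I) auto
    then have "sorted_wrt (\<lambda>i j. dist (q i) (q j) = simplex_edge (CARD('n) + 1)) I"
      by (rule sorted_wrt_mono_rel[rotated]) (rule qq_edge)
    then show "equidistant (simplex_edge (CARD('n) + 1)) (p # map q I)"
      using pq_edge by (simp add: equidistant_def sorted_wrt_map)
  qed
qed

theorem theorem4p1:
  fixes s :: real
  assumes "s \<le> 2"
  shows "M_sets (sphere (0 :: real ^ 'n) 1) s (CARD('n) + 1) =
    {X. length X = CARD('n) + 1 \<and> set X \<subseteq> sphere 0 1 \<and>
        (\<exists>T. regular_simplex CARD('n) T \<and> set X = vertices T)}"
proof -
  obtain E :: "(real ^ 'n) list" where E: "length E = CARD('n) + 1" "set E \<subseteq> sphere 0 1"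
    "equidistant (simplex_edge (CARD('n) + 1)) E"
    by (rule ex_equidistant_sphere)
  have "2 \<le> CARD('n) + 1"
    by (simp add: Suc_le_eq)
  from M_sets_sphere_equidistant[OF assms this E] show ?thesis
    using equidistant_iff_regular_simplex[where 'a = "real ^ 'n"] by auto
qed

end
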